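(* Let $(\mathfrak{g}, ([\,,]_{\omega})_{\omega\in\Omega}, p)$ be a matching Hom-Lie algebra. Consider a linear combination $$[\,,]_A:=\sum_{\omega\in \Omega} a_\omega [\,,]_\omega,\qquad a_\omega \in \mathbf{k},$$ where $(a_\omega)_{\omega\in\Omega}$ has finite support. Then $(\mathfrak{g}, [\,,]_A, p)$ is a Hom-Lie algebra.
   Context: Let $\mathbf{k}$ be a unitary commutative ring, the base ring of all modules, linear maps and tensor products, and let $\Omega$ be a nonempty set. A matching Hom-Lie algebra is a $\mathbf{k}$-module $\mathfrak{g}$ equipped with a collection of binary ($\mathbf{k}$-bilinear) operations $[\,,]_{\omega}: \mathfrak{g} \otimes \mathfrak{g} \rightarrow \mathfrak{g}$, $\omega \in \Omega$, and a linear map $p: \mathfrak{g} \rightarrow \mathfrak{g}$ such that $[x,x]_{\omega}=0$ and $$[p(x), [y,z]_{\beta}]_{\alpha}+ [p(y),[z,x]_{\alpha}]_{\beta}+[p(z),[x,y]_{\alpha}]_{\beta}=0$$ for all $x,y,z \in \mathfrak{g}$ and $\alpha,\beta, \omega \in \Omega$. A Hom-Lie algebra is a triple $(\mathfrak{g},[\,,],p)$ consisting of a $\mathbf{k}$-module $\mathfrak{g}$, a bilinear bracket $[\,,]:\mathfrak{g}\otimes\mathfrak{g}\to\mathfrak{g}$ with $[x,x]=0$ for all $x$ (hence skew-symmetric), and a linear map $p:\mathfrak{g}\to\mathfrak{g}$ satisfying the Hom-Jacobi identity $[p(x),[y,z]]+[p(y),[z,x]]+[p(z),[x,y]]=0$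 for all $x,y,z\in\mathfrak{g}$. *)

theory Defs
  imports "HOL-Algebra.Module"
begin

text \<open>The base ring is a HOL-Algebra \<open>cring\<close>, so the zero ring is not excluded. The ring
  multiplication that the record type of \<open>M\<close> inherits is never used: the locale \<open>module\<close>
  constrains only its additive group and scalar action. All maps are total functions whose values
  outside the carriers are irrelevant.\<close>

definition linear_map ::
    "('k, 'r) ring_scheme \<Rightarrow> ('k, 'g, 'm) module_scheme \<Rightarrow> ('k, 'h, 'n) module_scheme
      \<Rightarrow> ('g \<Rightarrow> 'h) \<Rightarrow> bool" where
  "linear_map R M N f \<longleftrightarrow>
     f \<in> hom (add_monoid M) (add_monoid N) \<and>
     (\<forall>c\<in>carrier R. \<forall>x\<in>carrier M. f (c \<odot>\<^bsub>M\<^esub> x) = c \<odot>\<^bsub>N\<^esub> f x)"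

text \<open>Linear maps out of the tensor square of \<open>M\<close> are rendered as bilinear maps.\<close>

definition bilinear_op ::
    "('k, 'r) ring_scheme \<Rightarrow> ('k, 'g, 'm) module_scheme \<Rightarrow> ('g \<Rightarrow> 'g \<Rightarrow> 'g) \<Rightarrow> bool" where
  "bilinear_op R M b \<longleftrightarrow>
     (\<forall>x\<in>carrier M. linear_map R M M (\<lambda>y. b x y)) \<and>
     (\<forall>y\<in>carrier M. linear_map R M M (\<lambda>x. b x y))"

locale hom_lie_algebra = module R M
  for R :: "('k, 'r) ring_scheme" and M :: "('k, 'g, 'm) module_scheme" +
  fixes br :: "'g \<Rightarrow> 'g \<Rightarrow> 'g" and p :: "'g \<Rightarrow> 'g"
  assumes br_bilinear: "bilinear_op R M br"
    and p_linear: "linear_map R M M p"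
    and br_alternating: "x \<in> carrier M \<Longrightarrow> br x x = \<zero>\<^bsub>M\<^esub>"
    and hom_jacobi: "\<lbrakk>x \<in> carrier M; y \<in> carrier M; z \<in> carrier M\<rbrakk> \<Longrightarrow>
      br (p x) (br y z) \<oplus>\<^bsub>M\<^esub> br (p y) (br z x) \<oplus>\<^bsub>M\<^esub> br (p z) (br x y) = \<zero>\<^bsub>M\<^esub>"

locale matching_hom_lie_algebra = module R M
  for R :: "('k, 'r) ring_scheme" and M :: "('k, 'g, 'm) module_scheme" +
  fixes \<Omega> :: "'w set" and br :: "'w \<Rightarrow> 'g \<Rightarrow> 'g \<Rightarrow> 'g" and p :: "'g \<Rightarrow> 'g"
  assumes index_nonempty: "\<Omega> \<noteq> {}"
    and br_bilinear: "\<omega> \<in> \<Omega> \<Longrightarrow> bilinear_op R M (br \<omega>)"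
    and p_linear: "linear_map R M M p"
    and br_alternating: "\<lbrakk>\<omega> \<in> \<Omega>; x \<in> carrier M\<rbrakk> \<Longrightarrow> br \<omega> x x = \<zero>\<^bsub>M\<^esub>"
    and matching_hom_jacobi:
      "\<lbrakk>\<alpha> \<in> \<Omega>; \<beta> \<in> \<Omega>; x \<in> carrier M; y \<in> carrier M; z \<in> carrier M\<rbrakk> \<Longrightarrow>
        br \<alpha> (p x) (br \<beta> y z) \<oplus>\<^bsub>M\<^esub> br \<beta> (p y) (br \<alpha> z x) \<oplus>\<^bsub>M\<^esub> br \<beta> (p z) (br \<alpha> x y) = \<zero>\<^bsub>M\<^esub>"

text \<open>The sum runs over the support of \<open>a\<close> because \<open>finsum\<close> over an infinite set is \<open>\<zero>\<close> by
  convention.\<close>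

definition comb_bracket ::
    "('k, 'r) ring_scheme \<Rightarrow> ('k, 'g, 'm) module_scheme \<Rightarrow> 'w set \<Rightarrow> ('w \<Rightarrow> 'k)
      \<Rightarrow> ('w \<Rightarrow> 'g \<Rightarrow> 'g \<Rightarrow> 'g) \<Rightarrow> 'g \<Rightarrow> 'g \<Rightarrow> 'g" where
  "comb_bracket R M \<Omega> a br x y =
     (\<Oplus>\<^bsub>M\<^esub>\<omega>\<in>{\<omega>\<in>\<Omega>. a \<omega> \<noteq> \<zero>\<^bsub>R\<^esub>}. a \<omega> \<odot>\<^bsub>M\<^esub> br \<omega> x y)"

end

theory Submission
  imports Defs
begin

text \<open>Linear combinations of bilinear alternating operations are again bilinear and alternating, so
  the content is the Hom-Jacobi identity. Expanding by bilinearity, each of its three terms becomes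
  a double sum over pairs \<open>(\<alpha>, \<beta>)\<close> of indices with weights \<open>a \<alpha> \<otimes> a \<beta>\<close>
  (\<open>comb_bracket_nested\<close>). In the matching identity the first term carries \<open>\<alpha>\<close> on the outer bracket
  and \<open>\<beta>\<close> on the inner one, while the other two carry them in the opposite order. The weights are
  symmetric because the base ring is commutative, so the second and third double sums keep their
  value when the roles of \<open>\<alpha>\<close> and \<open>\<beta>\<close> are exchanged (\<open>weighted_double_sum_transpose\<close>). After this
  exchange the coefficient of \<open>a \<alpha> \<otimes> a \<beta>\<close> in the whole sum is exactly the left-hand side of the
  matching identity, which vanishes.\<close>

lemma (in abelian_monoid) finsum_swap:
  assumes "finite A" and "finite B"
    and "\<And>i j. \<lbrakk>i \<in> A; j \<in> B\<rbrakk> \<Longrightarrow> f i j \<in> carrier G"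
  shows "(\<Oplus>i\<in>A. \<Oplus>j\<in>B. f i j) = (\<Oplus>j\<in>B. \<Oplus>i\<in>A. f i j)"
  using assms(1,3)
proof (induction A rule: finite_induct)
  case empty
  then show ?case by (simp add: finsum_zero)
next
  case (insert k A)
  have "(\<Oplus>i\<in>insert k A. \<Oplus>j\<in>B. f i j) = (\<Oplus>j\<in>B. f k j) \<oplus> (\<Oplus>j\<in>B. \<Oplus>i\<in>A. f i j)"
    using insert by (simp add: Pi_def)
  also have "\<dots> = (\<Oplus>j\<in>B. f k j \<oplus> (\<Oplus>i\<in>A. f i j))"
    using insert.prems by (subst finsum_addf) (auto simp: Pi_def)
  also have "\<dots> = (\<Oplus>j\<in>B. \<Oplus>i\<in>insert k A. f i j)"
    using insert by (intro finsum_cong') (auto simp: Pi_def)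
  finally show ?case .
qed

lemma linear_mapI:
  assumes "\<And>x. x \<in> carrier M \<Longrightarrow> f x \<in> carrier N"
    and "\<And>x y. \<lbrakk>x \<in> carrier M; y \<in> carrier M\<rbrakk> \<Longrightarrow> f (x \<oplus>\<^bsub>M\<^esub> y) = f x \<oplus>\<^bsub>N\<^esub> f y"
    and "\<And>c x. \<lbrakk>c \<in> carrier R; x \<in> carrier M\<rbrakk> \<Longrightarrow> f (c \<odot>\<^bsub>M\<^esub> x) = c \<odot>\<^bsub>N\<^esub> f x"
  shows "linear_map R M N f"
  using assms by (auto simp: linear_map_def hom_def)

lemma linear_map_closed:
  "\<lbrakk>linear_map R M N f; x \<in> carrier M\<rbrakk> \<Longrightarrow> f x \<in> carrier N"
  by (auto simp: linear_map_def hom_def)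

lemma linear_map_add:
  "\<lbrakk>linear_map R M N f; x \<in> carrier M; y \<in> carrier M\<rbrakk> \<Longrightarrow> f (x \<oplus>\<^bsub>M\<^esub> y) = f x \<oplus>\<^bsub>N\<^esub> f y"
  by (auto simp: linear_map_def hom_def)

lemma linear_map_smult:
  "\<lbrakk>linear_map R M N f; c \<in> carrier R; x \<in> carrier M\<rbrakk> \<Longrightarrow> f (c \<odot>\<^bsub>M\<^esub> x) = c \<odot>\<^bsub>N\<^esub> f x"
  by (auto simp: linear_map_def)

lemma linear_map_zero:
  assumes "module R M" and "module R N" and "linear_map R M N f"
  shows "f \<zero>\<^bsub>M\<^esub> = \<zero>\<^bsub>N\<^esub>"
proof -
  interpret M: module R M by fact
  interpret N: module R N by fact
  have "f \<zero>\<^bsub>M\<^esub> = f (\<zero>\<^bsub>R\<^esub> \<odot>\<^bsub>M\<^esub> \<zero>\<^bsub>M\<^esub>)" by simp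
  also have "\<dots> = \<zero>\<^bsub>R\<^esub> \<odot>\<^bsub>N\<^esub> f \<zero>\<^bsub>M\<^esub>"
    using assms(3) by (intro linear_map_smult) auto
  also have "\<dots> = \<zero>\<^bsub>N\<^esub>"
    using linear_map_closed[OF assms(3)] by simp
  finally show ?thesis .
qed

lemma linear_map_linear_combination:
  assumes "module R M" and "module R N" and f: "linear_map R M N f"
    and "finite S" and "\<And>i. i \<in> S \<Longrightarrow> a i \<in> carrier R" and "\<And>i. i \<in> S \<Longrightarrow> v i \<in> carrier M"
  shows "f (\<Oplus>\<^bsub>M\<^esub>i\<in>S. a i \<odot>\<^bsub>M\<^esub> v i) = (\<Oplus>\<^bsub>N\<^esub>i\<in>S. a i \<odot>\<^bsub>N\<^esub> f (v i))"
proof -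
  interpret M: module R M by fact
  interpret N: module R N by fact
  from assms(4-6) show ?thesis
  proof (induction S rule: finite_induct)
    case empty
    then show ?case using linear_map_zero[OF assms(1-3)] by simp
  next
    case (insert k S)
    then show ?case
      by (simp add: Pi_def linear_map_add[OF f] linear_map_smult[OF f] linear_map_closed[OF f])
  qed
qed

lemma linear_combination_linear_map:
  assumes "module R M" and "module R N" and "finite S"
    and a: "\<And>i. i \<in> S \<Longrightarrow> a i \<in> carrier R" and f: "\<And>i. i \<in> S \<Longrightarrow> linear_map R M N (f i)"
  shows "linear_map R M N (\<lambda>x. \<Oplus>\<^bsub>N\<^esub>i\<in>S. a i \<odot>\<^bsub>N\<^esub> f i x)"
proof -
  interpret M: module R M by fact
  interpret N: module R N by fact
  note closed = linear_map_closed[OF f]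
  show ?thesis
  proof (rule linear_mapI)
    fix x assume "x \<in> carrier M"
    then show "(\<Oplus>\<^bsub>N\<^esub>i\<in>S. a i \<odot>\<^bsub>N\<^esub> f i x) \<in> carrier N"
      using a closed by (auto intro!: N.finsum_closed)
  next
    fix x y assume xy: "x \<in> carrier M" "y \<in> carrier M"
    then have "(\<Oplus>\<^bsub>N\<^esub>i\<in>S. a i \<odot>\<^bsub>N\<^esub> f i (x \<oplus>\<^bsub>M\<^esub> y))
        = (\<Oplus>\<^bsub>N\<^esub>i\<in>S. a i \<odot>\<^bsub>N\<^esub> f i x \<oplus>\<^bsub>N\<^esub> a i \<odot>\<^bsub>N\<^esub> f i y)"
      using a closed
      by (intro N.finsum_cong') (auto simp: linear_map_add[OF f] N.smult_r_distr)
    also have "\<dots> = (\<Oplus>\<^bsub>N\<^esub>i\<in>S. a i \<odot>\<^bsub>N\<^esub> f i x) \<oplus>\<^bsub>N\<^esub> (\<Oplus>\<^bsub>N\<^esub>i\<in>S. a i \<odot>\<^bsub>N\<^esub> f i y)"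
      using a closed xy by (intro N.finsum_addf) auto
    finally show "(\<Oplus>\<^bsub>N\<^esub>i\<in>S. a i \<odot>\<^bsub>N\<^esub> f i (x \<oplus>\<^bsub>M\<^esub> y))
        = (\<Oplus>\<^bsub>N\<^esub>i\<in>S. a i \<odot>\<^bsub>N\<^esub> f i x) \<oplus>\<^bsub>N\<^esub> (\<Oplus>\<^bsub>N\<^esub>i\<in>S. a i \<odot>\<^bsub>N\<^esub> f i y)" .
  next
    fix c x assume cx: "c \<in> carrier R" "x \<in> carrier M"
    have "(\<Oplus>\<^bsub>N\<^esub>i\<in>S. a i \<odot>\<^bsub>N\<^esub> f i (c \<odot>\<^bsub>M\<^esub> x)) = (\<Oplus>\<^bsub>N\<^esub>i\<in>S. c \<odot>\<^bsub>N\<^esub> (a i \<odot>\<^bsub>N\<^esub> f i x))"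
    proof (intro N.finsum_cong' refl)
      fix i assume i: "i \<in> S"
      \<comment> \<open>Commutativity of the base ring makes scaling by \<open>a i\<close> compatible with scaling by \<open>c\<close>.\<close>
      then show "a i \<odot>\<^bsub>N\<^esub> f i (c \<odot>\<^bsub>M\<^esub> x) = c \<odot>\<^bsub>N\<^esub> (a i \<odot>\<^bsub>N\<^esub> f i x)"
        using cx a closed
        by (simp add: linear_map_smult[OF f] M.R.m_comm flip: N.smult_assoc1)
    qed (use cx a closed in auto)
    also have "\<dots> = c \<odot>\<^bsub>N\<^esub> (\<Oplus>\<^bsub>N\<^esub>i\<in>S. a i \<odot>\<^bsub>N\<^esub> f i x)"
      using cx a closed \<open>finite S\<close> by (intro N.finsum_smult_ldistr[symmetric]) auto
    finally show "(\<Oplus>\<^bsub>N\<^esub>i\<in>S. a i \<odot>\<^bsub>N\<^esub> f i (c \<odot>\<^bsub>M\<^esub> x)) = c \<odot>\<^bsub>N\<^esub> (\<Oplus>\<^bsub>N\<^esub>i\<in>S. a i \<odot>\<^bsub>N\<^esub> f i x)" .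
  qed
qed

lemma bilinear_op_closed:
  "\<lbrakk>bilinear_op R M b; x \<in> carrier M; y \<in> carrier M\<rbrakk> \<Longrightarrow> b x y \<in> carrier M"
  unfolding bilinear_op_def using linear_map_closed by metis

lemma comb_bracket_bilinear:
  assumes "module R M" and "finite {\<omega>\<in>\<Omega>. a \<omega> \<noteq> \<zero>\<^bsub>R\<^esub>}"
    and "\<And>\<omega>. \<omega> \<in> \<Omega> \<Longrightarrow> a \<omega> \<in> carrier R"
    and "\<And>\<omega>. \<omega> \<in> \<Omega> \<Longrightarrow> bilinear_op R M (br \<omega>)"
  shows "bilinear_op R M (comb_bracket R M \<Omega> a br)"
  unfolding bilinear_op_def comb_bracket_def
  using assms by (auto simp: bilinear_op_def intro!: linear_combination_linear_map)

definition weighted_double_sum ::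
    "('k, 'r) ring_scheme \<Rightarrow> ('k, 'g, 'm) module_scheme \<Rightarrow> 'w set \<Rightarrow> ('w \<Rightarrow> 'k)
      \<Rightarrow> ('w \<Rightarrow> 'w \<Rightarrow> 'g) \<Rightarrow> 'g" where
  "weighted_double_sum R M S a T =
     (\<Oplus>\<^bsub>M\<^esub>i\<in>S. \<Oplus>\<^bsub>M\<^esub>j\<in>S. (a i \<otimes>\<^bsub>R\<^esub> a j) \<odot>\<^bsub>M\<^esub> T i j)"

context module
begin

lemma weighted_double_sum_add:
  assumes "\<And>i. i \<in> S \<Longrightarrow> a i \<in> carrier R"
    and "\<And>i j. \<lbrakk>i \<in> S; j \<in> S\<rbrakk> \<Longrightarrow> T i j \<in> carrier M"
    and "\<And>i j. \<lbrakk>i \<in> S; j \<in> S\<rbrakk> \<Longrightarrow> U i j \<in> carrier M"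
  shows "weighted_double_sum R M S a T \<oplus>\<^bsub>M\<^esub> weighted_double_sum R M S a U
       = weighted_double_sum R M S a (\<lambda>i j. T i j \<oplus>\<^bsub>M\<^esub> U i j)"
proof -
  have "weighted_double_sum R M S a (\<lambda>i j. T i j \<oplus>\<^bsub>M\<^esub> U i j)
      = (\<Oplus>\<^bsub>M\<^esub>i\<in>S. (\<Oplus>\<^bsub>M\<^esub>j\<in>S. (a i \<otimes> a j) \<odot>\<^bsub>M\<^esub> T i j) \<oplus>\<^bsub>M\<^esub> (\<Oplus>\<^bsub>M\<^esub>j\<in>S. (a i \<otimes> a j) \<odot>\<^bsub>M\<^esub> U i j))"
    unfolding weighted_double_sum_def
  proof (intro M.finsum_cong' refl)
    fix i assume "i \<in> S"
    then have "(\<Oplus>\<^bsub>M\<^esub>j\<in>S. (a i \<otimes> a j) \<odot>\<^bsub>M\<^esub> (T i j \<oplus>\<^bsub>M\<^esub> U i j))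
        = (\<Oplus>\<^bsub>M\<^esub>j\<in>S. (a i \<otimes> a j) \<odot>\<^bsub>M\<^esub> T i j \<oplus>\<^bsub>M\<^esub> (a i \<otimes> a j) \<odot>\<^bsub>M\<^esub> U i j)"
      using assms by (intro M.finsum_cong') (auto simp: smult_r_distr)
    also have "\<dots> = (\<Oplus>\<^bsub>M\<^esub>j\<in>S. (a i \<otimes> a j) \<odot>\<^bsub>M\<^esub> T i j) \<oplus>\<^bsub>M\<^esub> (\<Oplus>\<^bsub>M\<^esub>j\<in>S. (a i \<otimes> a j) \<odot>\<^bsub>M\<^esub> U i j)"
      using assms \<open>i \<in> S\<close> by (intro M.finsum_addf) auto
    finally show "(\<Oplus>\<^bsub>M\<^esub>j\<in>S. (a i \<otimes> a j) \<odot>\<^bsub>M\<^esub> (T i j \<oplus>\<^bsub>M\<^esub> U i j)) = \<dots>" .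
  qed (use assms in \<open>auto intro!: M.finsum_closed M.a_closed\<close>)
  also have "\<dots> = weighted_double_sum R M S a T \<oplus>\<^bsub>M\<^esub> weighted_double_sum R M S a U"
    unfolding weighted_double_sum_def
    using assms by (intro M.finsum_addf) (auto intro!: M.finsum_closed)
  finally show ?thesis by simp
qed

text \<open>The weights \<open>a i \<otimes> a j\<close> are symmetric in \<open>i\<close> and \<open>j\<close>, so exchanging the two summations only
  transposes the family of vectors.\<close>

lemma weighted_double_sum_transpose:
  assumes "finite S" and "\<And>i. i \<in> S \<Longrightarrow> a i \<in> carrier R"
    and "\<And>i j. \<lbrakk>i \<in> S; j \<in> S\<rbrakk> \<Longrightarrow> T i j \<in> carrier M"
  shows "weighted_double_sum R M S a T = weighted_double_sum R M S a (\<lambda>i j. T j i)"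
proof -
  have "weighted_double_sum R M S a T = (\<Oplus>\<^bsub>M\<^esub>j\<in>S. \<Oplus>\<^bsub>M\<^esub>i\<in>S. (a i \<otimes> a j) \<odot>\<^bsub>M\<^esub> T i j)"
    unfolding weighted_double_sum_def using assms by (intro M.finsum_swap) auto
  also have "\<dots> = weighted_double_sum R M S a (\<lambda>i j. T j i)"
    unfolding weighted_double_sum_def
    using assms by (intro M.finsum_cong') (auto simp: R.m_comm intro!: M.finsum_closed)
  finally show ?thesis .
qed

lemma weighted_double_sum_zero:
  assumes "\<And>i. i \<in> S \<Longrightarrow> a i \<in> carrier R"
    and "\<And>i j. \<lbrakk>i \<in> S; j \<in> S\<rbrakk> \<Longrightarrow> T i j = \<zero>\<^bsub>M\<^esub>"
  shows "weighted_double_sum R M S a T = \<zero>\<^bsub>M\<^esub>"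
  unfolding weighted_double_sum_def
  using assms by (intro M.add.finprod_one_eqI) auto

lemma comb_bracket_nested:
  assumes fin: "finite {\<omega>\<in>\<Omega>. a \<omega> \<noteq> \<zero>}"
    and a: "\<And>\<omega>. \<omega> \<in> \<Omega> \<Longrightarrow> a \<omega> \<in> carrier R"
    and br: "\<And>\<omega>. \<omega> \<in> \<Omega> \<Longrightarrow> bilinear_op R M (br \<omega>)"
    and "u \<in> carrier M" and "v \<in> carrier M" and "w \<in> carrier M"
  shows "comb_bracket R M \<Omega> a br u (comb_bracket R M \<Omega> a br v w)
       = weighted_double_sum R M {\<omega>\<in>\<Omega>. a \<omega> \<noteq> \<zero>} a (\<lambda>\<alpha> \<beta>. br \<alpha> u (br \<beta> v w))"
proof -
  let ?S = "{\<omega>\<in>\<Omega>. a \<omega> \<noteq> \<zero>}"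
  note closed = bilinear_op_closed[OF br]
  have expand: "a \<alpha> \<odot>\<^bsub>M\<^esub> br \<alpha> u (\<Oplus>\<^bsub>M\<^esub>\<beta>\<in>?S. a \<beta> \<odot>\<^bsub>M\<^esub> br \<beta> v w)
      = (\<Oplus>\<^bsub>M\<^esub>\<beta>\<in>?S. (a \<alpha> \<otimes> a \<beta>) \<odot>\<^bsub>M\<^esub> br \<alpha> u (br \<beta> v w))" if "\<alpha> \<in> ?S" for \<alpha>
  proof -
    have lin: "linear_map R M M (br \<alpha> u)"
      using br[of \<alpha>] that \<open>u \<in> carrier M\<close> by (auto simp: bilinear_op_def)
    have "a \<alpha> \<odot>\<^bsub>M\<^esub> br \<alpha> u (\<Oplus>\<^bsub>M\<^esub>\<beta>\<in>?S. a \<beta> \<odot>\<^bsub>M\<^esub> br \<beta> v w)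
        = a \<alpha> \<odot>\<^bsub>M\<^esub> (\<Oplus>\<^bsub>M\<^esub>\<beta>\<in>?S. a \<beta> \<odot>\<^bsub>M\<^esub> br \<alpha> u (br \<beta> v w))"
      using assms closed
      by (subst linear_map_linear_combination[OF module_axioms module_axioms lin]) auto
    also have "\<dots> = (\<Oplus>\<^bsub>M\<^esub>\<beta>\<in>?S. a \<alpha> \<odot>\<^bsub>M\<^esub> (a \<beta> \<odot>\<^bsub>M\<^esub> br \<alpha> u (br \<beta> v w)))"
      using assms closed that by (intro finsum_smult_ldistr) auto
    also have "\<dots> = (\<Oplus>\<^bsub>M\<^esub>\<beta>\<in>?S. (a \<alpha> \<otimes> a \<beta>) \<odot>\<^bsub>M\<^esub> br \<alpha> u (br \<beta> v w))"
      using assms closed that by (intro M.finsum_cong') (auto simp: smult_assoc1)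
    finally show ?thesis .
  qed
  show ?thesis
    unfolding comb_bracket_def weighted_double_sum_def
    using assms closed by (intro M.finsum_cong' expand) (auto intro!: M.finsum_closed)
qed

end

theorem proposition2p7:
  fixes R :: "('k, 'r) ring_scheme" and M :: "('k, 'g, 'm) module_scheme"
    and \<Omega> :: "'w set" and br :: "'w \<Rightarrow> 'g \<Rightarrow> 'g \<Rightarrow> 'g" and p :: "'g \<Rightarrow> 'g" and a :: "'w \<Rightarrow> 'k"
  assumes "matching_hom_lie_algebra R M \<Omega> br p"
    and "\<And>\<omega>. \<omega> \<in> \<Omega> \<Longrightarrow> a \<omega> \<in> carrier R"
    and "finite {\<omega>\<in>\<Omega>. a \<omega> \<noteq> \<zero>\<^bsub>R\<^esub>}"
  shows "hom_lie_algebra R M (comb_bracket R M \<Omega> a br) p"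
proof -
  interpret matching_hom_lie_algebra R M \<Omega> br p by fact
  let ?b = "comb_bracket R M \<Omega> a br"
  let ?D = "weighted_double_sum R M {\<omega>\<in>\<Omega>. a \<omega> \<noteq> \<zero>\<^bsub>R\<^esub>} a"
  note closed = bilinear_op_closed[OF br_bilinear]
  note p_closed = linear_map_closed[OF p_linear]
  note nested = comb_bracket_nested[OF assms(3,2) br_bilinear]
  show ?thesis
  proof unfold_locales
    show "bilinear_op R M ?b"
      by (rule comb_bracket_bilinear[OF module_axioms assms(3,2) br_bilinear])
    show "linear_map R M M p"
      by (rule p_linear)
  next
    fix x assume "x \<in> carrier M"
    then show "?b x x = \<zero>\<^bsub>M\<^esub>"
      unfolding comb_bracket_def
      using assms(2) by (intro M.add.finprod_one_eqI) (auto simp: br_alternating)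
  next
    fix x y z assume xyz: "x \<in> carrier M" "y \<in> carrier M" "z \<in> carrier M"
    let ?X = "\<lambda>\<alpha> \<beta>. br \<alpha> (p x) (br \<beta> y z)"
    let ?Y = "\<lambda>\<alpha> \<beta>. br \<beta> (p y) (br \<alpha> z x)"
    let ?Z = "\<lambda>\<alpha> \<beta>. br \<beta> (p z) (br \<alpha> x y)"
    have T: "?X \<alpha> \<beta> \<in> carrier M" "?Y \<alpha> \<beta> \<in> carrier M" "?Z \<alpha> \<beta> \<in> carrier M"
      if "\<alpha> \<in> {\<omega>\<in>\<Omega>. a \<omega> \<noteq> \<zero>\<^bsub>R\<^esub>}" "\<beta> \<in> {\<omega>\<in>\<Omega>. a \<omega> \<noteq> \<zero>\<^bsub>R\<^esub>}" for \<alpha> \<beta>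
      using that xyz by (simp_all add: closed p_closed)
    have X: "?b (p x) (?b y z) = ?D ?X"
      using xyz p_closed by (intro nested)
    \<comment> \<open>The last two terms are transposed to match the index pattern of the matching identity.\<close>
    have "?b (p y) (?b z x) = ?D (\<lambda>\<alpha> \<beta>. ?Y \<beta> \<alpha>)"
      using xyz p_closed by (intro nested)
    also have "\<dots> = ?D ?Y"
      using assms(2) T by (intro weighted_double_sum_transpose[OF assms(3)]) auto
    finally have Y: "?b (p y) (?b z x) = ?D ?Y" .
    have "?b (p z) (?b x y) = ?D (\<lambda>\<alpha> \<beta>. ?Z \<beta> \<alpha>)"
      using xyz p_closed by (intro nested)
    also have "\<dots> = ?D ?Z"
      using assms(2) T by (intro weighted_double_sum_transpose[OF assms(3)]) auto
    finally have Z: "?b (p z) (?b x y) = ?D ?Z" .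
    have "?D ?X \<oplus>\<^bsub>M\<^esub> ?D ?Y \<oplus>\<^bsub>M\<^esub> ?D ?Z = ?D (\<lambda>\<alpha> \<beta>. ?X \<alpha> \<beta> \<oplus>\<^bsub>M\<^esub> ?Y \<alpha> \<beta>) \<oplus>\<^bsub>M\<^esub> ?D ?Z"
      using assms(2) T by (subst weighted_double_sum_add) auto
    also have "\<dots> = ?D (\<lambda>\<alpha> \<beta>. ?X \<alpha> \<beta> \<oplus>\<^bsub>M\<^esub> ?Y \<alpha> \<beta> \<oplus>\<^bsub>M\<^esub> ?Z \<alpha> \<beta>)"
      using assms(2) T by (intro weighted_double_sum_add) auto
    also have "\<dots> = \<zero>\<^bsub>M\<^esub>"
      using xyz assms(2)
      by (intro weighted_double_sum_zero matching_hom_jacobi) auto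
    finally show "?b (p x) (?b y z) \<oplus>\<^bsub>M\<^esub> ?b (p y) (?b z x) \<oplus>\<^bsub>M\<^esub> ?b (p z) (?b x y) = \<zero>\<^bsub>M\<^esub>"
      by (simp only: X Y Z)
  qed
qed

end
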